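(* Let $q>2$ be a prime power, $d\ge 2$, $K=\mathbb F_{q^d}$, $\alpha$ a primitive element of $K$, and $n_q=(q^d-1)/(q-1)$. Let $r,t$ be nonnegative integers with $r\equiv t\pmod{q-1}$, let $u,v\in K^*$, and put $H(x)=ux^r+vx^t$. Suppose that $H(x)\neq 0$ for all $x\in K^*$ and that the induced map $[x]\mapsto[H(x)]$ is a permutation of $K^*/\mathbb F_q^*$. Let $F_H$ be the permutation of $\mathbb Z_{n_q}$ for which $F_H(i)$ is the unique $j\in\mathbb Z_{n_q}$ with $H(\alpha^i)\in\mathbb F_q^*\alpha^j$. If $$\gcd(r-t,\,q^d-1)=q-1,$$ then $\delta(F_H)\le q-1$. In particular, when $q=3$, every binomial $H$ satisfying all these hypotheses induces an APN permutation $F_H$ of $\mathbb Z_{(3^d-1)/2}$.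
   Context: $\mathbb Z_n=\mathbb Z/n\mathbb Z$. The differential uniformity of $F:\mathbb Z_n\to\mathbb Z_n$ is $\delta(F)=\max_{a\neq 0,\,b\in\mathbb Z_n}\#\{x\in\mathbb Z_n: F(x+a)-F(x)=b\}$, and $F$ is called APN if $\delta(F)=2$. The points of $\mathrm{PG}(d-1,q)$ are identified with $K^*/\mathbb F_q^*$, and $[x]$ denotes the class $\mathbb F_q^*x$ of $x\in K^*$ (equivalently the one-dimensional $\mathbb F_q$-subspace $\mathbb F_qx$). The map $i\mapsto[\alpha^i]$ is a bijection $\mathbb Z_{n_q}\to K^*/\mathbb F_q^*$. The congruence $r\equiv t\pmod{q-1}$ makes $[x]\mapsto[H(x)]$ independent of the chosen representative. *)

theory Defs
  imports "HOL-Number_Theory.Number_Theory" "HOL-Library.Cardinality"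
begin

definition is_subfield :: "'a::field set \<Rightarrow> bool" where
  "is_subfield F \<longleftrightarrow> 0 \<in> F \<and> 1 \<in> F \<and>
     (\<forall>x\<in>F. \<forall>y\<in>F. x + y \<in> F \<and> x * y \<in> F) \<and>
     (\<forall>x\<in>F. - x \<in> F \<and> inverse x \<in> F)"

definition primitive_element :: "'a::field \<Rightarrow> bool" where
  "primitive_element \<alpha> \<longleftrightarrow> range (\<lambda>i::nat. \<alpha> ^ i) = UNIV - {0}"

text \<open>The class of a nonzero \<open>x\<close> modulo multiplication by \<open>F - {0}\<close>.\<close>

definition proj_class :: "'a::field set \<Rightarrow> 'a \<Rightarrow> 'a set" where
  "proj_class F x = {c * x | c. c \<in> F - {0}}"

definition proj_points :: "'a::field set \<Rightarrow> 'a set set" where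
  "proj_points F = proj_class F ` (UNIV - {0})"

text \<open>The existence of \<open>\<phi>\<close> includes that \<open>[x] \<mapsto> [H x]\<close> is well defined; \<open>\<phi>\<close> is unique on points.\<close>

definition induces_proj_permutation :: "'a::field set \<Rightarrow> ('a \<Rightarrow> 'a) \<Rightarrow> bool" where
  "induces_proj_permutation F H \<longleftrightarrow>
     (\<exists>\<phi>. bij_betw \<phi> (proj_points F) (proj_points F) \<and>
          (\<forall>x. x \<noteq> 0 \<longrightarrow> \<phi> (proj_class F x) = proj_class F (H x)))"

text \<open>Residues modulo \<open>n\<close> are represented by \<open>{..<n}\<close>; a map on them is a function
  \<open>nat \<Rightarrow> nat\<close> of which only the values on \<open>{..<n}\<close> matter. The subtraction takes place
  in \<open>int\<close>, so it is not truncated. The maximum is over a nonempty set when \<open>n \<ge> 2\<close>.\<close>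

definition diff_uniformity :: "nat \<Rightarrow> (nat \<Rightarrow> nat) \<Rightarrow> nat" where
  "diff_uniformity n f =
     Max {card {x \<in> {..<n}. (int (f ((x + a) mod n)) - int (f x)) mod int n = int b} | a b.
            a \<in> {..<n} \<and> a \<noteq> 0 \<and> b \<in> {..<n}}"

definition APN :: "nat \<Rightarrow> (nat \<Rightarrow> nat) \<Rightarrow> bool" where
  "APN n f \<longleftrightarrow> diff_uniformity n f = 2"

definition index_map :: "'a::field set \<Rightarrow> 'a \<Rightarrow> nat \<Rightarrow> ('a \<Rightarrow> 'a) \<Rightarrow> nat \<Rightarrow> nat" where
  "index_map F \<alpha> n H i = (THE j. j \<in> {..<n} \<and> H (\<alpha> ^ i) \<in> proj_class F (\<alpha> ^ j))"

end

theory Submission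
  imports Defs "HOL-Computational_Algebra.Polynomial"
begin

text \<open>
  The powers of \<open>\<alpha>\<close> identify \<open>\<int>\<^sub>n\<close> with the projective points, so
  \<open>F\<^sub>H(i + a) - F\<^sub>H(i) = b\<close> says that, for \<open>x = \<alpha>\<^sup>i\<close> and \<open>A = \<alpha>\<^sup>a\<close>,
  the quotient \<open>H(Ax) / (\<alpha>\<^sup>b H(x))\<close> is a scalar \<open>c\<close> in the small field. There are \<open>q - 1\<close>
  possible scalars, and each one comes from at most one point \<open>[x]\<close>: for fixed
  \<open>B = c\<alpha>\<^sup>b\<close> the equation \<open>H(Ax) = B H(x)\<close> reads
  \<open>u(A\<^sup>r - B) x\<^sup>r = v(B - A\<^sup>t) x\<^sup>t\<close>, which is a condition on \<open>x\<^sup>r / x\<^sup>t\<close> alone.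
  By the gcd hypothesis, \<open>z\<^sup>r = z\<^sup>t\<close> holds exactly for the scalars \<open>z\<close>; hence
  \<open>x\<^sup>r / x\<^sup>t\<close> determines \<open>[x]\<close>. The equation could degenerate only for
  \<open>A\<^sup>r = B = A\<^sup>t\<close>, that is, for \<open>A\<close> a scalar, which \<open>a \<noteq> 0\<close> excludes.
  This is \<open>card_derivative_fibre_le\<close>.

  Conversely, no permutation of \<open>\<int>\<^sub>n\<close> with \<open>n \<ge> 2\<close> has differential uniformity \<open>1\<close>: its
  derivatives omit the value \<open>0\<close>, so they cannot be injective
  (\<open>diff_uniformity_permutation_ge_2\<close>). For \<open>q = 3\<close> the two bounds meet.
\<close>

section \<open>Differential uniformity of maps on residues\<close>

definition derivative_fibre :: "nat \<Rightarrow> (nat \<Rightarrow> nat) \<Rightarrow> nat \<Rightarrow> nat \<Rightarrow> nat set" where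
  "derivative_fibre n f a b =
     {x \<in> {..<n}. (int (f ((x + a) mod n)) - int (f x)) mod int n = int b}"

lemma diff_uniformity_eq_Max:
  "diff_uniformity n f =
     Max ((\<lambda>(a, b). card (derivative_fibre n f a b)) ` ({1..<n} \<times> {..<n}))"
proof -
  have "{card (derivative_fibre n f a b) | a b. a \<in> {..<n} \<and> a \<noteq> 0 \<and> b \<in> {..<n}} =
      (\<lambda>(a, b). card (derivative_fibre n f a b)) ` ({1..<n} \<times> {..<n})"
    by force
  moreover have "diff_uniformity n f =
      Max {card (derivative_fibre n f a b) | a b. a \<in> {..<n} \<and> a \<noteq> 0 \<and> b \<in> {..<n}}"
    by (simp only: diff_uniformity_def derivative_fibre_def)
  ultimately show ?thesis by simp
qed

lemma diff_uniformity_leI: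
  assumes "n \<ge> 2"
    and "\<And>a b. a < n \<Longrightarrow> a \<noteq> 0 \<Longrightarrow> b < n \<Longrightarrow> card (derivative_fibre n f a b) \<le> m"
  shows "diff_uniformity n f \<le> m"
  unfolding diff_uniformity_eq_Max
  by (rule Max.boundedI) (use assms in \<open>auto simp: lessThan_empty_iff\<close>)

lemma diff_uniformity_geI:
  assumes "a < n" "a \<noteq> 0" "b < n"
  shows "card (derivative_fibre n f a b) \<le> diff_uniformity n f"
  unfolding diff_uniformity_eq_Max
  by (rule Max_ge) (use assms in \<open>auto intro!: image_eqI[of _ _ "(a, b)"]\<close>)

text \<open>The derivative in direction \<open>1\<close> maps \<open>n\<close> residues to the \<open>n - 1\<close> nonzero residues, since
  an injective map takes different values at \<open>x\<close> and \<open>x + 1\<close>; so two residues collide.\<close>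

lemma diff_uniformity_permutation_ge_2:
  assumes n: "n \<ge> 2" and bij: "bij_betw f {..<n} {..<n}"
  shows "diff_uniformity n f \<ge> 2"
proof -
  define D where "D x = nat ((int (f ((x + 1) mod n)) - int (f x)) mod int n)" for x
  have D_int: "int (D x) = (int (f ((x + 1) mod n)) - int (f x)) mod int n" for x
    using n pos_mod_sign[of "int n"] by (simp only: D_def int_nat_eq if_True)
  have "D ` {..<n} \<subseteq> {1..<n}"
  proof
    fix y assume "y \<in> D ` {..<n}"
    then obtain x where x: "x < n" and y: "y = D x" by auto
    have lt: "D x < n"
    proof -
      have "int (D x) < int n" unfolding D_int by (rule pos_mod_bound) (use n in simp)
      then show ?thesis by simp
    qed
    have "D x \<noteq> 0"
    proof
      assume "D x = 0"
      then have "int (f ((x + 1) mod n)) mod int n = int (f x) mod int n"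
        using D_int[of x] by (simp add: mod_eq_dvd_iff dvd_eq_mod_eq_0)
      moreover have "f ((x + 1) mod n) < n" "f x < n"
        using bij x n by (auto simp: bij_betw_def)
      ultimately have "f ((x + 1) mod n) = f x"
        by (metis mod_less of_nat_eq_iff zmod_int)
      then have "(x + 1) mod n = x"
        using bij x n by (auto simp: bij_betw_def inj_on_def)
      then show False
        using x n by (cases "x + 1 = n") auto
    qed
    then show "y \<in> {1..<n}" using lt y by auto
  qed
  then have "card (D ` {..<n}) \<le> n - 1"
    using card_mono[of "{1..<n}" "D ` {..<n}"] by simp
  then have "card (D ` {..<n}) < card {..<n}" using n by simp
  then obtain x y where xy: "x < n" "y < n" "x \<noteq> y" "D x = D y"
    using pigeonhole[of D "{..<n}"] by (auto simp: inj_on_def)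
  have "D x < n"
    using \<open>D ` {..<n} \<subseteq> {1..<n}\<close> xy by auto
  have "{x, y} \<subseteq> derivative_fibre n f 1 (D x)"
    using xy D_int[of x] D_int[of y] by (simp add: derivative_fibre_def)
  then have "card {x, y} \<le> card (derivative_fibre n f 1 (D x))"
    by (rule card_mono[rotated]) (simp add: derivative_fibre_def)
  also have "\<dots> \<le> diff_uniformity n f"
    using diff_uniformity_geI[of 1 n "D x" f] n \<open>D x < n\<close> by simp
  finally show ?thesis using xy by simp
qed

section \<open>Subfields and projective points of a finite field\<close>

lemma subfield_mult: "is_subfield F \<Longrightarrow> x \<in> F \<Longrightarrow> y \<in> F \<Longrightarrow> x * y \<in> F"
  by (simp add: is_subfield_def)

lemma subfield_inverse: "is_subfield F \<Longrightarrow> x \<in> F \<Longrightarrow> inverse x \<in> F"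
  by (simp add: is_subfield_def)

lemma subfield_divide: "is_subfield F \<Longrightarrow> x \<in> F \<Longrightarrow> y \<in> F \<Longrightarrow> x / y \<in> F"
  by (simp add: divide_inverse subfield_mult subfield_inverse)

lemma is_subfield_UNIV: "is_subfield (UNIV :: 'a::field set)"
  by (simp add: is_subfield_def)

lemma mem_proj_class_iff:
  assumes "is_subfield F" "x \<noteq> 0" "y \<noteq> 0"
  shows "x \<in> proj_class F y \<longleftrightarrow> x / y \<in> F"
proof
  assume "x \<in> proj_class F y"
  then show "x / y \<in> F" using assms by (auto simp: proj_class_def)
next
  assume "x / y \<in> F"
  moreover have "x = x / y * y" "x / y \<noteq> 0" using assms by auto
  ultimately show "x \<in> proj_class F y" unfolding proj_class_def by blast
qed

lemma proj_class_eq_iff: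
  assumes F: "is_subfield F" and "x \<noteq> 0" "y \<noteq> 0"
  shows "proj_class F x = proj_class F y \<longleftrightarrow> x / y \<in> F"
proof
  assume "proj_class F x = proj_class F y"
  moreover have "x \<in> proj_class F x"
    using assms by (simp add: mem_proj_class_iff is_subfield_def)
  ultimately show "x / y \<in> F"
    using assms mem_proj_class_iff by blast
next
  have sub: "proj_class F a \<subseteq> proj_class F b" if "a / b \<in> F" "a \<noteq> 0" "b \<noteq> 0" for a b
  proof
    fix z assume "z \<in> proj_class F a"
    then obtain c where c: "c \<in> F" "c \<noteq> 0" "z = c * a"
      by (auto simp: proj_class_def)
    then have "z / b \<in> F" using subfield_mult[OF F, of c "a / b"] that by simp
    then show "z \<in> proj_class F b" using c that F by (simp add: mem_proj_class_iff)
  qed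
  assume "x / y \<in> F"
  moreover from this have "y / x \<in> F"
    using subfield_inverse[OF F, of "x / y"] by simp
  ultimately show "proj_class F x = proj_class F y"
    using sub assms by blast
qed

lemma induced_map_respects_classes:
  assumes "induces_proj_permutation F H" "x \<noteq> 0" "y \<noteq> 0" "proj_class F x = proj_class F y"
  shows "proj_class F (H x) = proj_class F (H y)"
  using assms unfolding induces_proj_permutation_def by metis

lemma induced_map_reflects_classes:
  assumes "induces_proj_permutation F H" "x \<noteq> 0" "y \<noteq> 0"
    and "proj_class F (H x) = proj_class F (H y)"
  shows "proj_class F x = proj_class F y"
proof -
  obtain \<phi> where "bij_betw \<phi> (proj_points F) (proj_points F)"
    and "\<forall>x. x \<noteq> 0 \<longrightarrow> \<phi> (proj_class F x) = proj_class F (H x)"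
    using assms(1) unfolding induces_proj_permutation_def by blast
  moreover have "proj_class F x \<in> proj_points F" "proj_class F y \<in> proj_points F"
    using assms by (auto simp: proj_points_def)
  ultimately show ?thesis
    using assms by (auto simp: bij_betw_def inj_on_def)
qed

text \<open>Multiplication by a nonzero \<open>z\<close> permutes the units of the subfield, so it leaves their
  product unchanged.\<close>

lemma subfield_unit_power:
  fixes F :: "'a::{field,finite} set"
  assumes F: "is_subfield F" and z: "z \<in> F" "z \<noteq> 0"
  shows "z ^ (card F - 1) = 1"
proof -
  have "bij_betw ((*) z) (F - {0}) (F - {0})"
    by (rule bij_betw_byWitness[where f' = "\<lambda>x. x / z"])
       (use z F in \<open>auto intro: subfield_mult subfield_divide\<close>)
  then have "(\<Prod>x\<in>F - {0}. z * x) = (\<Prod>x\<in>F - {0}. x)"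
    by (rule prod.reindex_bij_betw)
  then have "z ^ card (F - {0}) * (\<Prod>x\<in>F - {0}. x) = (\<Prod>x\<in>F - {0}. x)"
    by (simp add: prod.distrib)
  moreover have "(\<Prod>x\<in>F - {0}. x) \<noteq> 0" by simp
  moreover have "card (F - {0}) = card F - 1"
    using F by (simp add: is_subfield_def)
  ultimately show ?thesis by simp
qed

text \<open>The units of the subfield already exhaust the at most \<open>card F - 1\<close> roots of
  \<open>X\<^sup>k - 1\<close> with \<open>k = card F - 1\<close>.\<close>

lemma subfield_mem_iff_power:
  fixes F :: "'a::{field,finite} set"
  assumes F: "is_subfield F" and z: "z \<noteq> 0"
  shows "z \<in> F \<longleftrightarrow> z ^ (card F - 1) = 1"
proof -
  define k where "k = card F - 1"
  have "{0, 1} \<subseteq> F" using F by (simp add: is_subfield_def)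
  from card_mono[OF _ this] have k: "k > 0" by (simp add: k_def)
  define p :: "'a poly" where "p = monom 1 k - 1"
  have cp: "coeff p k = 1"
    using k by (simp add: p_def coeff_1)
  then have p0: "p \<noteq> 0" by auto
  have "degree p \<le> k"
    unfolding p_def by (intro degree_diff_le) (auto simp: degree_monom_le)
  have roots: "{x. poly p x = 0} = {x. x ^ k = 1}"
    by (simp add: p_def poly_monom)
  have "card {x::'a. x ^ k = 1} \<le> k"
    using card_poly_roots_bound[OF p0] \<open>degree p \<le> k\<close> unfolding roots by linarith
  moreover have "F - {0} \<subseteq> {x. x ^ k = 1}"
    using subfield_unit_power[OF F] by (auto simp: k_def)
  moreover have "card (F - {0}) = k"
    using F by (simp add: k_def is_subfield_def)
  ultimately have "F - {0} = {x. x ^ k = 1}"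
    by (intro card_seteq) auto
  then show ?thesis using z by (auto simp: k_def)
qed

text \<open>Both \<open>r - t\<close> and the order of the full multiplicative group are exponents killing \<open>z\<close>,
  hence so is their gcd, and the elements killed by \<open>card F - 1\<close> are the units of \<open>F\<close>.\<close>

lemma subfield_mem_if_powers_eq:
  fixes F :: "'a::{field,finite} set"
  assumes F: "is_subfield F" and z: "z \<noteq> 0"
    and g: "gcd (int r - int t) (int CARD('a) - 1) = int (card F) - 1"
    and eq: "z ^ r = z ^ t"
  shows "z \<in> F"
proof -
  have r_t: "z powi (int r - int t) = 1"
    using eq z by (simp add: power_int_diff)
  have N: "z powi (int CARD('a) - 1) = 1"
    using subfield_unit_power[OF is_subfield_UNIV _ z]
    by (simp add: power_int_def nat_diff_distrib')
  obtain x y where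
    "int (card F) - 1 = x * (int r - int t) + y * (int CARD('a) - 1)"
    using bezout_int[of "int r - int t" "int CARD('a) - 1"] g by metis
  then have "z powi (int (card F) - 1)
      = (z powi (int r - int t)) powi x * (z powi (int CARD('a) - 1)) powi y"
    using z by (simp add: power_int_add mult.commute flip: power_int_mult)
  then have "z powi (int (card F) - 1) = 1"
    by (simp only: r_t N power_int_1_left mult_1)
  moreover have "card F > 0"
    using F by (auto simp: is_subfield_def card_gt_0_iff)
  ultimately have "z ^ (card F - 1) = 1"
    by (simp add: power_int_def nat_diff_distrib')
  then show ?thesis using subfield_mem_iff_power[OF F z] by simp
qed

section \<open>The equation \<open>H(Ax) = B H(x)\<close> for a binomial\<close>

text \<open>The only degenerate case is \<open>A\<^sup>r = B\<close>, and it forces \<open>B = A\<^sup>t\<close>.\<close>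

lemma binomial_scaling_solutions:
  fixes A B u v x y :: "'a::field"
  assumes nz: "u \<noteq> 0" "v \<noteq> 0" "x \<noteq> 0" "y \<noteq> 0"
    and x: "u * (A * x) ^ r + v * (A * x) ^ t = B * (u * x ^ r + v * x ^ t)"
    and y: "u * (A * y) ^ r + v * (A * y) ^ t = B * (u * y ^ r + v * y ^ t)"
    and A: "A ^ r \<noteq> A ^ t"
  shows "(x / y) ^ r = (x / y) ^ t"
proof -
  have ex: "u * (A ^ r - B) * x ^ r = v * (B - A ^ t) * x ^ t"
    using x by (simp add: algebra_simps power_mult_distrib)
  have ey: "u * (A ^ r - B) * y ^ r = v * (B - A ^ t) * y ^ t"
    using y by (simp add: algebra_simps power_mult_distrib)
  have "A ^ r \<noteq> B"
  proof
    assume "A ^ r = B"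
    with ex nz have "B = A ^ t" by simp
    with A \<open>A ^ r = B\<close> show False by simp
  qed
  have "(u * (A ^ r - B)) * (x ^ r * y ^ t) = (v * (B - A ^ t) * x ^ t) * y ^ t"
    by (simp add: ex flip: mult.assoc)
  also have "\<dots> = (v * (B - A ^ t) * y ^ t) * x ^ t" by (simp add: mult_ac)
  also have "\<dots> = (u * (A ^ r - B)) * (y ^ r * x ^ t)"
    by (simp add: ey flip: mult.assoc)
  finally have "x ^ r * y ^ t = y ^ r * x ^ t"
    using nz \<open>A ^ r \<noteq> B\<close> by simp
  then show ?thesis using nz by (simp add: power_divide field_simps)
qed

section \<open>Projective points as powers of a primitive element\<close>

text \<open>The multiplicative form of \<open>n_points\<close> makes \<open>n\<close> the number of projective points
  without a separate divisibility fact.\<close>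

locale primitive_over_subfield =
  fixes F :: "'a::{field,finite} set" and \<alpha> :: 'a and n :: nat
  assumes subfield: "is_subfield F"
    and primitive: "primitive_element \<alpha>"
    and n_points: "n * (card F - 1) = CARD('a) - 1"
begin

lemma nonzero: "\<alpha> \<noteq> 0"
proof
  assume "\<alpha> = 0"
  moreover have "\<alpha> ^ 1 \<in> UNIV - {0}"
    using primitive unfolding primitive_element_def by blast
  ultimately show False by simp
qed

lemma ex_power: "x \<noteq> 0 \<Longrightarrow> \<exists>i. x = \<alpha> ^ i"
  using primitive unfolding primitive_element_def by blast

lemma card_F: "card F \<ge> 2"
proof -
  have "{0, 1} \<subseteq> F" using subfield by (simp add: is_subfield_def)
  from card_mono[OF _ this] show ?thesis by simp
qed

lemma n_pos: "n > 0"
proof -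
  have "CARD('a) \<ge> 2" using card_F card_mono[of UNIV F] by simp
  then show ?thesis using n_points by (cases n) auto
qed

text \<open>If \<open>\<alpha>\<^sup>m = 1\<close> with \<open>m > 0\<close>, then \<open>\<alpha>\<close> has at most \<open>m\<close> powers; so the order of \<open>\<alpha>\<close> is not
  smaller than the number of units.\<close>

lemma power_eq_1_iff: "\<alpha> ^ k = 1 \<longleftrightarrow> CARD('a) - 1 dvd k"
proof
  let ?N = "CARD('a) - 1"
  have "0 < n * (card F - 1)" using n_pos card_F by simp
  then have N: "?N > 0" by (simp only: n_points)
  have one: "\<alpha> ^ ?N = 1"
    using subfield_unit_power[OF is_subfield_UNIV _ nonzero] by simp
  then show "\<alpha> ^ k = 1" if "?N dvd k"
    using that by (auto simp: power_mult)
  assume "\<alpha> ^ k = 1"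
  define m where "m = k mod ?N"
  have "\<alpha> ^ k = (\<alpha> ^ ?N) ^ (k div ?N) * \<alpha> ^ m"
    by (simp add: m_def flip: power_mult power_add)
  then have m1: "\<alpha> ^ m = 1" using one \<open>\<alpha> ^ k = 1\<close> by simp
  have "m = 0"
  proof (rule ccontr)
    assume "m \<noteq> 0"
    have "UNIV - {0} \<subseteq> (\<lambda>i. \<alpha> ^ i) ` {..<m}"
    proof
      fix x :: 'a assume "x \<in> UNIV - {0}"
      then obtain i where "x = \<alpha> ^ i" using ex_power by auto
      also have "\<dots> = (\<alpha> ^ m) ^ (i div m) * \<alpha> ^ (i mod m)"
        by (simp flip: power_mult power_add)
      finally have "x = \<alpha> ^ (i mod m)" using m1 by simp
      then show "x \<in> (\<lambda>i. \<alpha> ^ i) ` {..<m}" using \<open>m \<noteq> 0\<close> by auto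
    qed
    from card_mono[OF _ this] have "?N \<le> card ((\<lambda>i. \<alpha> ^ i) ` {..<m})"
      by (simp add: card_Diff_singleton)
    also have "\<dots> \<le> m" using card_image_le[of "{..<m}"] by simp
    finally show False using mod_less_divisor[OF N, of k] by (simp only: m_def not_le)
  qed
  then show "?N dvd k" by (simp add: m_def dvd_eq_mod_eq_0)
qed

lemma power_mem_iff: "\<alpha> ^ k \<in> F \<longleftrightarrow> n dvd k"
proof -
  have "\<alpha> ^ k \<in> F \<longleftrightarrow> \<alpha> ^ (k * (card F - 1)) = 1"
    using subfield_mem_iff_power[OF subfield] nonzero by (simp add: power_mult)
  also have "\<dots> \<longleftrightarrow> n * (card F - 1) dvd k * (card F - 1)"
    by (simp only: power_eq_1_iff n_points)
  also have "\<dots> \<longleftrightarrow> n dvd k" using card_F by simp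
  finally show ?thesis .
qed

lemma power_class_eq_iff: "proj_class F (\<alpha> ^ i) = proj_class F (\<alpha> ^ j) \<longleftrightarrow> [i = j] (mod n)"
proof -
  have *: "proj_class F (\<alpha> ^ i) = proj_class F (\<alpha> ^ j) \<longleftrightarrow> [i = j] (mod n)"
    if "j \<le> i" for i j
  proof -
    have "\<alpha> ^ i / \<alpha> ^ j = \<alpha> ^ (i - j)"
      using that nonzero by (simp add: power_diff)
    then show ?thesis
      using that nonzero subfield
      by (simp add: proj_class_eq_iff power_mem_iff cong_altdef_nat)
  qed
  show ?thesis
    using *[of i j] *[of j i] by (cases "j \<le> i") (auto simp: cong_sym_eq)
qed

lemma index_map_props:
  assumes "H (\<alpha> ^ i) \<noteq> 0"
  shows index_map_less: "index_map F \<alpha> n H i < n"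
    and index_map_class: "proj_class F (H (\<alpha> ^ i)) = proj_class F (\<alpha> ^ index_map F \<alpha> n H i)"
proof -
  have mem: "H (\<alpha> ^ i) \<in> proj_class F (\<alpha> ^ j) \<longleftrightarrow>
      proj_class F (H (\<alpha> ^ i)) = proj_class F (\<alpha> ^ j)" for j
    using assms nonzero subfield by (simp add: mem_proj_class_iff proj_class_eq_iff)
  obtain k where k: "H (\<alpha> ^ i) = \<alpha> ^ k" using ex_power assms by blast
  have "\<exists>!j. j \<in> {..<n} \<and> H (\<alpha> ^ i) \<in> proj_class F (\<alpha> ^ j)"
  proof (rule ex1I[of _ "k mod n"])
    show "k mod n \<in> {..<n} \<and> H (\<alpha> ^ i) \<in> proj_class F (\<alpha> ^ (k mod n))"
      unfolding mem unfolding k power_class_eq_iff using n_pos by (simp add: cong_def)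
  next
    fix j assume "j \<in> {..<n} \<and> H (\<alpha> ^ i) \<in> proj_class F (\<alpha> ^ j)"
    then show "j = k mod n"
      unfolding mem unfolding k power_class_eq_iff by (simp add: cong_def)
  qed
  from theI'[OF this] have "index_map F \<alpha> n H i \<in> {..<n} \<and>
      H (\<alpha> ^ i) \<in> proj_class F (\<alpha> ^ index_map F \<alpha> n H i)"
    by (simp only: index_map_def)
  then show "index_map F \<alpha> n H i < n"
    and "proj_class F (H (\<alpha> ^ i)) = proj_class F (\<alpha> ^ index_map F \<alpha> n H i)"
    by (auto simp only: mem lessThan_iff)
qed

lemma index_map_bij:
  assumes H: "\<And>x. x \<noteq> 0 \<Longrightarrow> H x \<noteq> 0" and ind: "induces_proj_permutation F H"
  shows "bij_betw (index_map F \<alpha> n H) {..<n} {..<n}"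
proof -
  have "inj_on (index_map F \<alpha> n H) {..<n}"
  proof (rule inj_onI)
    fix i j assume ij: "i \<in> {..<n}" "j \<in> {..<n}" "index_map F \<alpha> n H i = index_map F \<alpha> n H j"
    then have "proj_class F (H (\<alpha> ^ i)) = proj_class F (H (\<alpha> ^ j))"
      using index_map_class H nonzero by simp
    then have "proj_class F (\<alpha> ^ i) = proj_class F (\<alpha> ^ j)"
      using induced_map_reflects_classes[OF ind, of "\<alpha> ^ i" "\<alpha> ^ j"] nonzero by simp
    then have "[i = j] (mod n)" by (simp only: power_class_eq_iff)
    then show "i = j" using ij by (simp add: cong_def)
  qed
  moreover have "index_map F \<alpha> n H ` {..<n} \<subseteq> {..<n}"
    using index_map_less H nonzero by auto
  ultimately show ?thesis
    by (simp add: bij_betw_def endo_inj_surj)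
qed

text \<open>The scalar attached to a solution \<open>i\<close> of \<open>F\<^sub>H(i + a) - F\<^sub>H(i) = b\<close>. Reducing \<open>i + a\<close>
  modulo \<open>n\<close> changes \<open>\<alpha>\<^bsup>i + a\<^esup>\<close> by a scalar, to which the class of \<open>H\<close> is insensitive.\<close>

lemma derivative_scalar_mem:
  assumes H: "\<And>x. x \<noteq> 0 \<Longrightarrow> H x \<noteq> 0" and ind: "induces_proj_permutation F H"
    and eq: "(int (index_map F \<alpha> n H ((i + a) mod n)) - int (index_map F \<alpha> n H i)) mod int n = int b"
  shows "H (\<alpha> ^ a * \<alpha> ^ i) / (\<alpha> ^ b * H (\<alpha> ^ i)) \<in> F"
proof -
  let ?f = "index_map F \<alpha> n H"
  have "[int (?f ((i + a) mod n)) - int (?f i) = int b] (mod int n)"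
    by (simp add: cong_def flip: eq)
  then have "[int (?f ((i + a) mod n)) = int (b + ?f i)] (mod int n)"
    using cong_add[of _ _ "int n" "int (?f i)" "int (?f i)"] by fastforce
  then have f: "[?f ((i + a) mod n) = b + ?f i] (mod n)"
    by (simp only: cong_int_iff)
  have "proj_class F (\<alpha> ^ (i + a)) = proj_class F (\<alpha> ^ ((i + a) mod n))"
    by (simp add: power_class_eq_iff cong_def)
  then have "proj_class F (H (\<alpha> ^ (i + a))) = proj_class F (H (\<alpha> ^ ((i + a) mod n)))"
    using induced_map_respects_classes[OF ind] nonzero by simp
  also have "\<dots> = proj_class F (\<alpha> ^ ?f ((i + a) mod n))"
    using index_map_class H nonzero by simp
  also have "\<dots> = proj_class F (\<alpha> ^ (b + ?f i))"
    using f by (simp add: power_class_eq_iff)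
  finally have 1: "H (\<alpha> ^ (i + a)) / \<alpha> ^ (b + ?f i) \<in> F"
    using H nonzero subfield by (simp add: proj_class_eq_iff)
  have 2: "H (\<alpha> ^ i) / \<alpha> ^ ?f i \<in> F"
    using index_map_class[of H i] H nonzero subfield by (simp add: proj_class_eq_iff)
  have "H (\<alpha> ^ a * \<alpha> ^ i) / (\<alpha> ^ b * H (\<alpha> ^ i)) =
      (H (\<alpha> ^ (i + a)) / \<alpha> ^ (b + ?f i)) / (H (\<alpha> ^ i) / \<alpha> ^ ?f i)"
    using nonzero H by (simp add: power_add mult.commute)
  then show ?thesis using subfield_divide[OF subfield 1 2] by simp
qed

text \<open>Two solutions with the same scalar \<open>c\<close> solve the same equation \<open>H(Ax) = c\<alpha>\<^sup>b H(x)\<close>, so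
  they are the same projective point; and \<open>F\<close> has only \<open>card F - 1\<close> units.\<close>

lemma card_derivative_fibre_le:
  assumes uv: "u \<noteq> 0" "v \<noteq> 0"
    and H_def: "H = (\<lambda>x. u * x ^ r + v * x ^ t)"
    and H: "\<And>x. x \<noteq> 0 \<Longrightarrow> H x \<noteq> 0" and ind: "induces_proj_permutation F H"
    and g: "gcd (int r - int t) (int CARD('a) - 1) = int (card F) - 1"
    and a: "a < n" "a \<noteq> 0"
  shows "card (derivative_fibre n (index_map F \<alpha> n H) a b) \<le> card F - 1"
proof -
  let ?S = "derivative_fibre n (index_map F \<alpha> n H) a b"
  define c where "c i = H (\<alpha> ^ a * \<alpha> ^ i) / (\<alpha> ^ b * H (\<alpha> ^ i))" for i
  have A: "(\<alpha> ^ a) ^ r \<noteq> (\<alpha> ^ a) ^ t"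
  proof
    assume "(\<alpha> ^ a) ^ r = (\<alpha> ^ a) ^ t"
    then have "\<alpha> ^ a \<in> F"
      using subfield_mem_if_powers_eq[OF subfield _ g] nonzero by simp
    then show False using a by (simp add: power_mem_iff nat_dvd_not_less)
  qed
  have "inj_on c ?S"
  proof (rule inj_onI)
    fix i j assume i: "i \<in> ?S" and j: "j \<in> ?S" and cc: "c i = c j"
    have ci: "H (\<alpha> ^ a * \<alpha> ^ k) = (c k * \<alpha> ^ b) * H (\<alpha> ^ k)" for k
      using H nonzero by (simp add: c_def)
    have "(\<alpha> ^ i / \<alpha> ^ j) ^ r = (\<alpha> ^ i / \<alpha> ^ j) ^ t"
    proof (rule binomial_scaling_solutions[OF uv _ _ _ _ A])
      show "u * (\<alpha> ^ a * \<alpha> ^ i) ^ r + v * (\<alpha> ^ a * \<alpha> ^ i) ^ t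
          = (c i * \<alpha> ^ b) * (u * (\<alpha> ^ i) ^ r + v * (\<alpha> ^ i) ^ t)"
        using ci[of i] unfolding H_def .
      show "u * (\<alpha> ^ a * \<alpha> ^ j) ^ r + v * (\<alpha> ^ a * \<alpha> ^ j) ^ t
          = (c i * \<alpha> ^ b) * (u * (\<alpha> ^ j) ^ r + v * (\<alpha> ^ j) ^ t)"
        using ci[of j] unfolding H_def cc .
    qed (use nonzero in auto)
    then have "\<alpha> ^ i / \<alpha> ^ j \<in> F"
      using subfield_mem_if_powers_eq[OF subfield _ g] nonzero by simp
    then have "[i = j] (mod n)"
      using power_class_eq_iff proj_class_eq_iff[OF subfield] nonzero by simp
    then show "i = j" using i j by (simp add: cong_def derivative_fibre_def)
  qed
  moreover have "c ` ?S \<subseteq> F - {0}"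
    using derivative_scalar_mem[OF H ind] H nonzero by (auto simp: c_def derivative_fibre_def)
  ultimately have "card ?S \<le> card (F - {0})"
    by (intro card_inj_on_le) auto
  also have "\<dots> = card F - 1"
    using subfield by (simp add: is_subfield_def)
  finally show ?thesis .
qed

end

section \<open>The bound for binomial permutations\<close>

theorem theorem3:
  fixes Fq :: "'a::{field,finite} set"
    and \<alpha> u v :: 'a
    and H :: "'a \<Rightarrow> 'a"
    and q d n r t :: nat
  assumes "primepow q" and "q > 2" and "d \<ge> 2"
    and "CARD('a) = q ^ d"
    and "is_subfield Fq" and "card Fq = q"
    and "primitive_element \<alpha>"
    and "n = (q ^ d - 1) div (q - 1)"
    and "[r = t] (mod (q - 1))"
    and "u \<noteq> 0" and "v \<noteq> 0"
    and "H = (\<lambda>x. u * x ^ r + v * x ^ t)"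
    and "\<And>x. x \<noteq> 0 \<Longrightarrow> H x \<noteq> 0"
    and "induces_proj_permutation Fq H"
    and "gcd (int r - int t) (int q ^ d - 1) = int q - 1"
  shows "diff_uniformity n (index_map Fq \<alpha> n H) \<le> q - 1 \<and>
         (q = 3 \<longrightarrow>
            bij_betw (index_map Fq \<alpha> ((3 ^ d - 1) div 2) H)
              {..<(3 ^ d - 1) div 2} {..<(3 ^ d - 1) div 2} \<and>
            APN ((3 ^ d - 1) div 2) (index_map Fq \<alpha> ((3 ^ d - 1) div 2) H))"
proof -
  have factor: "n * (q - 1) = q ^ d - 1"
  proof -
    have "[q ^ d = 1 ^ d] (mod (q - 1))"
      by (rule cong_pow) (use assms(2) in \<open>simp add: cong_altdef_nat\<close>)
    then have "q - 1 dvd q ^ d - 1"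
      using assms(2) by (simp add: cong_altdef_nat)
    then show ?thesis by (simp add: assms(8))
  qed
  have "q ^ 1 < q ^ d"
    by (rule power_strict_increasing) (use assms(2,3) in auto)
  then have "q - 1 < n * (q - 1)" using factor assms(2) by simp
  then have n: "n \<ge> 2"
    by (cases "n = 0 \<or> n = 1") auto
  interpret primitive_over_subfield Fq \<alpha> n
    by unfold_locales (use assms(4-7) factor in auto)
  have g: "gcd (int r - int t) (int CARD('a) - 1) = int (card Fq) - 1"
    using assms(4,6,15) by simp
  have le: "diff_uniformity n (index_map Fq \<alpha> n H) \<le> q - 1"
    using diff_uniformity_leI[OF n]
      card_derivative_fibre_le[OF assms(10-14) g] assms(6) by simp
  have bij: "bij_betw (index_map Fq \<alpha> n H) {..<n} {..<n}"
    by (rule index_map_bij[OF assms(13,14)])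
  have "APN n (index_map Fq \<alpha> n H)" if "q = 3"
    using le diff_uniformity_permutation_ge_2[OF n bij] that by (simp add: APN_def)
  moreover have "(3 ^ d - 1) div 2 = n" if "q = 3"
    using assms(8) that by simp
  ultimately show ?thesis using le bij by simp
qed

end
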